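(* Every Dedekind-finite weakly l.f.g.u. monoid $H$ is factorable. If, in addition, every irreducible of $H$ is an (ordinary) atom, then $H$ is FmF-atomic.
   Context: Let $H$ be a (multiplicatively written) monoid with identity $1_H$ and group of units $H^\times$. $H$ is Dedekind-finite if the product of any two non-units is a non-unit. For $x,y \in H$ write $x \mid_H y$ ("$x$ is a divisor of $y$ in $H$") if $y \in HxH$; this is a preorder on $H$. Elements $x,y$ are $\mid_H$-equivalent if $x \mid_H y \mid_H x$. A $\mid_H$-unit is an element $\mid_H$-equivalent to $1_H$; other elements are $\mid_H$-non-units. (In a Dedekind-finite monoid the $\mid_H$-units are exactly the units.) An (ordinary) atom is a non-unit that is not a product of two non-units. A $\mid_H$-atom is a $\mid_H$-non-unit that is not a product of two $\mid_H$-non-units (when $H$ is Dedekind-finite, this is the same as an atom). An irreducible of $H$ is a $\mid_H$-non-unit $a$ such that $a \neq xy$ for all $\mid_H$-non-units $x,y$ that are proper divisors of $a$, i.e., $x \mid_H a$, $a \nmid_H x$, $y \mid_H a$, $a \nmid_H y$. $H$ is weakly l.f.g.u. if, for every $\mid_H$-non-unit $x$, letting $K$ be the submonoid of $H$ generated by all the divisors of $x$ in $H$ and $U$ the set of $\mid_H$-units of $H$ that lie in $K$, there is a finite $A \subseteq K$ such that $K$ is generated as a monoid by $UAU$. $H$ is factorable if every $\mid_H$-non-unit is a product of irreducibles. A $\mid_H$-factorization of $x$ is a finite word (tuple) of irreducibles of $H$ whose letters multiply, in order, to $x$. For finite words $\mathfrak a = a_1 \ast \cdots \ast a_m$ and $\mathfrak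 b = b_1 \ast \cdots \ast b_n$ of elements of $H$, write $\mathfrak a \sqsubseteq \mathfrak b$ if there is an injective $\sigma \colon \{1,\ldots,m\} \to \{1,\ldots,n\}$ such that $a_i$ is $\mid_H$-equivalent to $b_{\sigma(i)}$ for every $i$; words are $\sqsubseteq$-equivalent if $\mathfrak a \sqsubseteq \mathfrak b \sqsubseteq \mathfrak a$. A $\mid_H$-factorization $\mathfrak a$ of $x$ is minimal if there is no $\mid_H$-factorization $\mathfrak b$ of $x$ with $\mathfrak b \sqsubseteq \mathfrak a$ and not $\mathfrak a \sqsubseteq \mathfrak b$; it is a minimal atomic $\mid_H$-factorization if, in addition, all its letters are $\mid_H$-atoms. $H$ is FmF-atomic if, for every $\mid_H$-non-unit $x$, the set of minimal atomic $\mid_H$-factorizations of $x$ is non-empty and has finitely many $\sqsubseteq$-equivalence classes. *)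

theory Defs
  imports "HOL-Algebra.Coset"
begin

definition dedekind_finite :: "('a, 'b) monoid_scheme \<Rightarrow> bool" where
  "dedekind_finite H \<longleftrightarrow>
     (\<forall>x \<in> carrier H - Units H. \<forall>y \<in> carrier H - Units H. x \<otimes>\<^bsub>H\<^esub> y \<notin> Units H)"

(* Two-sided divisibility: y lies in HxH.  The relation "divides" of HOL-Algebra.Divisibility
   is one-sided and intended for commutative monoids. *)
definition mdvd :: "('a, 'b) monoid_scheme \<Rightarrow> 'a \<Rightarrow> 'a \<Rightarrow> bool" where
  "mdvd H x y \<longleftrightarrow> x \<in> carrier H \<and> y \<in> carrier H \<and>
     (\<exists>u \<in> carrier H. \<exists>v \<in> carrier H. y = u \<otimes>\<^bsub>H\<^esub> x \<otimes>\<^bsub>H\<^esub> v)"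

definition dvd_equiv :: "('a, 'b) monoid_scheme \<Rightarrow> 'a \<Rightarrow> 'a \<Rightarrow> bool" where
  "dvd_equiv H x y \<longleftrightarrow> mdvd H x y \<and> mdvd H y x"

definition dvd_units :: "('a, 'b) monoid_scheme \<Rightarrow> 'a set" where
  "dvd_units H = {x \<in> carrier H. dvd_equiv H x \<one>\<^bsub>H\<^esub>}"

definition dvd_nonunits :: "('a, 'b) monoid_scheme \<Rightarrow> 'a set" where
  "dvd_nonunits H = carrier H - dvd_units H"

definition ordinary_atom :: "('a, 'b) monoid_scheme \<Rightarrow> 'a \<Rightarrow> bool" where
  "ordinary_atom H a \<longleftrightarrow> a \<in> carrier H - Units H \<and>
     \<not> (\<exists>x \<in> carrier H - Units H. \<exists>y \<in> carrier H - Units H. a = x \<otimes>\<^bsub>H\<^esub> y)"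

definition dvd_atom :: "('a, 'b) monoid_scheme \<Rightarrow> 'a \<Rightarrow> bool" where
  "dvd_atom H a \<longleftrightarrow> a \<in> dvd_nonunits H \<and>
     \<not> (\<exists>x \<in> dvd_nonunits H. \<exists>y \<in> dvd_nonunits H. a = x \<otimes>\<^bsub>H\<^esub> y)"

definition proper_mdvd :: "('a, 'b) monoid_scheme \<Rightarrow> 'a \<Rightarrow> 'a \<Rightarrow> bool" where
  "proper_mdvd H x a \<longleftrightarrow> mdvd H x a \<and> \<not> mdvd H a x"

definition dvd_irreducible :: "('a, 'b) monoid_scheme \<Rightarrow> 'a \<Rightarrow> bool" where
  "dvd_irreducible H a \<longleftrightarrow> a \<in> dvd_nonunits H \<and>
     (\<forall>x \<in> dvd_nonunits H. \<forall>y \<in> dvd_nonunits H.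
        proper_mdvd H x a \<longrightarrow> proper_mdvd H y a \<longrightarrow> a \<noteq> x \<otimes>\<^bsub>H\<^esub> y)"

(* Intended for subsets S of the carrier; otherwise the intersection is over the empty family. *)
definition submonoid_generated :: "('a, 'b) monoid_scheme \<Rightarrow> 'a set \<Rightarrow> 'a set" where
  "submonoid_generated H S = \<Inter> {M. submonoid M H \<and> S \<subseteq> M}"

definition weakly_lfgu :: "('a, 'b) monoid_scheme \<Rightarrow> bool" where
  "weakly_lfgu H \<longleftrightarrow>
     (\<forall>x \<in> dvd_nonunits H.
        let K = submonoid_generated H {y. mdvd H y x};
            U = dvd_units H \<inter> K
        in \<exists>A. finite A \<and> A \<subseteq> K \<and> K = submonoid_generated H (U <#>\<^bsub>H\<^esub> A <#>\<^bsub>H\<^esub> U))"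

definition word_prod :: "('a, 'b) monoid_scheme \<Rightarrow> 'a list \<Rightarrow> 'a" where
  "word_prod H w = foldr (\<otimes>\<^bsub>H\<^esub>) w \<one>\<^bsub>H\<^esub>"

definition dvd_factorization :: "('a, 'b) monoid_scheme \<Rightarrow> 'a list \<Rightarrow> 'a \<Rightarrow> bool" where
  "dvd_factorization H w x \<longleftrightarrow> (\<forall>a \<in> set w. dvd_irreducible H a) \<and> word_prod H w = x"

definition factorable :: "('a, 'b) monoid_scheme \<Rightarrow> bool" where
  "factorable H \<longleftrightarrow> (\<forall>x \<in> dvd_nonunits H. \<exists>w. dvd_factorization H w x)"

definition word_le :: "('a, 'b) monoid_scheme \<Rightarrow> 'a list \<Rightarrow> 'a list \<Rightarrow> bool" where
  "word_le H v w \<longleftrightarrow>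
     (\<exists>\<sigma> :: nat \<Rightarrow> nat. inj_on \<sigma> {..<length v} \<and> \<sigma> ` {..<length v} \<subseteq> {..<length w} \<and>
        (\<forall>i < length v. dvd_equiv H (v ! i) (w ! \<sigma> i)))"

definition word_equiv :: "('a, 'b) monoid_scheme \<Rightarrow> 'a list \<Rightarrow> 'a list \<Rightarrow> bool" where
  "word_equiv H v w \<longleftrightarrow> word_le H v w \<and> word_le H w v"

definition minimal_factorization :: "('a, 'b) monoid_scheme \<Rightarrow> 'a list \<Rightarrow> 'a \<Rightarrow> bool" where
  "minimal_factorization H w x \<longleftrightarrow> dvd_factorization H w x \<and>
     \<not> (\<exists>v. dvd_factorization H v x \<and> word_le H v w \<and> \<not> word_le H w v)"

definition minimal_atomic_factorizations :: "('a, 'b) monoid_scheme \<Rightarrow> 'a \<Rightarrow> 'a list set" where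
  "minimal_atomic_factorizations H x =
     {w. minimal_factorization H w x \<and> (\<forall>a \<in> set w. dvd_atom H a)}"

definition FmF_atomic :: "('a, 'b) monoid_scheme \<Rightarrow> bool" where
  "FmF_atomic H \<longleftrightarrow>
     (\<forall>x \<in> dvd_nonunits H.
        let Z = minimal_atomic_factorizations H x
        in Z \<noteq> {} \<and> finite (Z // {(v, w). v \<in> Z \<and> w \<in> Z \<and> word_equiv H v w}))"

end

theory Submission
  imports Complex_Main Defs "HOL-Combinatorics.List_Permutation"
begin

text \<open>Fix a non-unit \<open>x\<close> and a finite set \<open>A\<close> such that every divisor of \<open>x\<close> is a product of
  elements \<open>u a v\<close> with \<open>a \<in> A\<close> and units \<open>u\<close>, \<open>v\<close>. Each letter of such a product divides the
  product. Hence, if \<open>a \<in> A\<close> divides \<open>x\<close> and is the product of two proper divisors, then each of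
  these is a product of elements \<open>u b v\<close> where \<open>b \<in> A\<close> properly divides \<open>a\<close>. As the preorder is
  well-founded on the finite set \<open>A\<close>, every divisor of \<open>x\<close> in \<open>A\<close>, and thus \<open>x\<close> itself, is a
  product of irreducibles. If irreducibles are atoms, those dividing \<open>x\<close> are equivalent to elements
  of \<open>A\<close>, so factorizations of \<open>x\<close> correspond to multisets over a finite set of classes, ordered by
  inclusion. A shortest factorization is minimal, and by Dickson's lemma there are finitely many
  minimal ones up to equivalence.\<close>

section \<open>Dickson's lemma\<close>

text \<open>Every sequence has a monotone subsequence. If that one is decreasing, well-ordering
  makes it constant from some point on, and its constant tail is weakly increasing.\<close>

lemma incseq_subseq_nat:
  fixes f :: "nat \<Rightarrow> nat"
  obtains r :: "nat \<Rightarrow> nat" where "strict_mono r" "incseq (f \<circ> r)"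
proof -
  obtain g :: "nat \<Rightarrow> nat" where g: "strict_mono g" "monoseq (\<lambda>n. f (g n))"
    using seq_monosub by blast
  show thesis
  proof (cases "incseq (\<lambda>n. f (g n))")
    case True
    then show thesis using g that by (auto simp: comp_def)
  next
    case False
    then have dec: "decseq (\<lambda>n. f (g n))"
      using g(2) by (simp add: monoseq_iff)
    \<comment> \<open>\<open>N\<close> is an index at which the least value is attained; a
      decreasing sequence cannot move after it.\<close>
    obtain N where N: "\<And>n. f (g N) \<le> f (g n)"
      using ex_has_least_nat[of "\<lambda>_. True" _ "\<lambda>n. f (g n)"] by auto
    have const: "f (g (n + N)) = f (g N)" for n
      using N[of "n + N"] decseqD[OF dec, of N "n + N"] by simp
    have "strict_mono (\<lambda>n. g (n + N))"
      using g(1) by (simp add: strict_mono_def)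
    moreover have "incseq (f \<circ> (\<lambda>n. g (n + N)))"
      by (simp add: incseq_def const)
    ultimately show thesis by (rule that)
  qed
qed

text \<open>The coordinates in \<open>S\<close> are treated one at a time: thinning the sequence for
  a new coordinate keeps it monotone in the earlier ones.\<close>

lemma incseq_subseq_finite:
  fixes f :: "nat \<Rightarrow> 'k \<Rightarrow> nat"
  assumes "finite S"
  shows "\<exists>r :: nat \<Rightarrow> nat. strict_mono r \<and> (\<forall>k\<in>S. incseq (\<lambda>n. f (r n) k))"
  using assms
proof (induction S)
  case empty
  show ?case by (intro exI[of _ id]) (auto simp: strict_mono_def)
next
  case (insert k S)
  then obtain r :: "nat \<Rightarrow> nat"
    where r: "strict_mono r" "\<And>k. k \<in> S \<Longrightarrow> incseq (\<lambda>n. f (r n) k)"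
    by blast
  obtain s :: "nat \<Rightarrow> nat" where s: "strict_mono s" "incseq ((\<lambda>n. f (r n) k) \<circ> s)"
    using incseq_subseq_nat by blast
  have "incseq (\<lambda>n. f (r (s n)) l)" if "l \<in> S" for l
    using r(2)[OF that] s(1) by (simp add: incseq_def strict_mono_less_eq)
  moreover have "strict_mono (\<lambda>n. r (s n))"
    using r(1) s(1) by (simp add: strict_mono_def)
  ultimately show ?case
    using s(2) by (intro exI[of _ "\<lambda>n. r (s n)"]) (auto simp: comp_def)
qed

text \<open>This is Dickson's lemma, with multisets over \<open>S\<close> as exponent vectors. An
  infinite family would contain an injective sequence whose multiplicities weakly increase along a
  subsequence; two of its terms would be comparable, hence equal.\<close>

lemma finite_multiset_antichain:
  assumes "finite S"
    and support: "\<And>M. M \<in> F \<Longrightarrow> set_mset M \<subseteq> S"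
    and antichain: "\<And>M N. M \<in> F \<Longrightarrow> N \<in> F \<Longrightarrow> M \<subseteq># N \<Longrightarrow> M = N"
  shows "finite F"
proof (rule ccontr)
  assume "infinite F"
  then obtain f :: "nat \<Rightarrow> 'a multiset" where f: "inj f" "range f \<subseteq> F"
    using infinite_countable_subset by blast
  obtain r :: "nat \<Rightarrow> nat"
    where r: "strict_mono r" "\<And>k. k \<in> S \<Longrightarrow> incseq (\<lambda>n. count (f (r n)) k)"
    using incseq_subseq_finite[OF \<open>finite S\<close>, where f = "\<lambda>n. count (f n)"] by blast
  \<comment> \<open>Outside \<open>S\<close> the left-hand multiplicity is 0 because of the support
    condition.\<close>
  have "count (f (r 0)) k \<le> count (f (r 1)) k" for k
  proof (cases "k \<in> S")
    case True
    then show ?thesis using incseqD[OF r(2)] by blast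
  next
    case False
    then have "k \<notin># f (r 0)" using support f(2) by blast
    then show ?thesis by (simp add: not_in_iff)
  qed
  then have "f (r 0) = f (r 1)"
    using f(2) by (intro antichain) (auto simp: subseteq_mset_def)
  then have "r 0 = r 1" using f(1) by (simp add: inj_eq)
  then show False using strict_monoD[OF r(1), of 0 1] by simp
qed

section \<open>Injections between words as multiset inclusions\<close>

text \<open>The multiset of a word is the image of its set of positions. Reindexing along the
  injection \<open>\<sigma>\<close> turns the positions of \<open>xs\<close> into a subset of those
  of \<open>ys\<close>.\<close>

lemma mset_subset_eq_if_inj:
  assumes inj: "inj_on \<sigma> {..<length xs}"
    and range: "\<sigma> ` {..<length xs} \<subseteq> {..<length ys}"
    and nth: "\<And>i. i < length xs \<Longrightarrow> xs ! i = ys ! \<sigma> i"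
  shows "mset xs \<subseteq># mset ys"
proof -
  have nths: "mset zs = image_mset ((!) zs) (mset_set {..<length zs})" for zs :: "'a list"
    by (metis map_nth mset_map mset_upt atLeast0LessThan)
  have "mset xs = image_mset (\<lambda>i. ys ! \<sigma> i) (mset_set {..<length xs})"
    unfolding nths[of xs] by (rule image_mset_cong) (simp add: nth)
  also have "\<dots> = image_mset ((!) ys) (mset_set (\<sigma> ` {..<length xs}))"
    by (simp add: image_mset_mset_set[OF inj, symmetric] multiset.map_comp comp_def)
  also have "\<dots> \<subseteq># image_mset ((!) ys) (mset_set {..<length ys})"
    using range by (intro image_mset_subseteq_mono) (simp add: subset_imp_msubset_mset_set)
  finally show ?thesis by (simp add: nths[of ys])
qed

text \<open>Appending the missing letters \<open>zs\<close> to \<open>xs\<close> gives a permutation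
  of \<open>ys\<close>; the bijection of positions is then restricted to the initial segment
  occupied by \<open>xs\<close>.\<close>

lemma inj_if_mset_subset_eq:
  assumes "mset xs \<subseteq># mset ys"
  obtains \<sigma> where "inj_on \<sigma> {..<length xs}" "\<sigma> ` {..<length xs} \<subseteq> {..<length ys}"
    "\<And>i. i < length xs \<Longrightarrow> xs ! i = ys ! \<sigma> i"
proof -
  obtain zs where zs: "mset zs = mset ys - mset xs"
    using ex_mset by blast
  then have "mset (xs @ zs) = mset ys"
    using assms by simp
  then obtain f where f: "bij_betw f {..<length (xs @ zs)} {..<length ys}"
    "\<And>i. i < length (xs @ zs) \<Longrightarrow> (xs @ zs) ! i = ys ! f i"
    using permutation_Ex_bij by blast
  show thesis
  proof (rule that)
    show "inj_on f {..<length xs}"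
      using f(1) by (rule inj_on_subset[OF bij_betw_imp_inj_on]) auto
    show "f ` {..<length xs} \<subseteq> {..<length ys}"
      using bij_betw_imp_surj_on[OF f(1)] by auto
    show "xs ! i = ys ! f i" if "i < length xs" for i
      using f(2)[of i] that by (simp add: nth_append)
  qed
qed

section \<open>Divisibility and words\<close>

context monoid
begin

lemma mdvd_refl: "x \<in> carrier G \<Longrightarrow> mdvd G x x"
  unfolding mdvd_def by (metis one_closed l_one r_one)

lemma mdvd_trans:
  assumes "mdvd G x y" "mdvd G y z"
  shows "mdvd G x z"
proof -
  obtain u v where uv: "u \<in> carrier G" "v \<in> carrier G" "y = u \<otimes> x \<otimes> v" and x: "x \<in> carrier G"
    using assms(1) by (auto simp: mdvd_def)
  obtain s t where st: "s \<in> carrier G" "t \<in> carrier G" "z = s \<otimes> y \<otimes> t" and z: "z \<in> carrier G"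
    using assms(2) by (auto simp: mdvd_def)
  have "z = (s \<otimes> u) \<otimes> x \<otimes> (v \<otimes> t)"
    using uv st x by (simp add: m_assoc)
  then show ?thesis
    using uv st x z unfolding mdvd_def by blast
qed

text \<open>Representing an element by its set of equivalents turns equivalence of letters into
  equality, so that words can be compared through multisets of classes.\<close>

lemma dvd_equiv_class_eq_iff:
  assumes "x \<in> carrier G"
  shows "Collect (dvd_equiv G x) = Collect (dvd_equiv G y) \<longleftrightarrow> dvd_equiv G x y"
  using assms mdvd_refl[of x] mdvd_trans unfolding dvd_equiv_def by blast

lemma mdvd_mult_left: "x \<in> carrier G \<Longrightarrow> y \<in> carrier G \<Longrightarrow> mdvd G x (x \<otimes> y)"
  unfolding mdvd_def by (metis one_closed l_one m_closed)

lemma mdvd_mult_right: "x \<in> carrier G \<Longrightarrow> y \<in> carrier G \<Longrightarrow> mdvd G y (x \<otimes> y)"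
  unfolding mdvd_def by (metis one_closed r_one m_closed)

lemma dvd_equiv_Units_mult:
  assumes a: "a \<in> carrier G" and u: "u \<in> Units G" and v: "v \<in> Units G"
  shows "dvd_equiv G (u \<otimes> a \<otimes> v) a"
proof -
  have "a = inv u \<otimes> (u \<otimes> a \<otimes> v) \<otimes> inv v"
    using a u v by (metis Units_closed Units_inv_closed m_assoc m_closed Units_l_inv Units_r_inv l_one r_one)
  then show ?thesis
    using a u v unfolding dvd_equiv_def mdvd_def
    by (metis Units_closed Units_inv_closed m_closed)
qed

section \<open>Products of words and generated submonoids\<close>

lemma word_prod_Nil [simp]: "word_prod G [] = \<one>"
  by (simp add: word_prod_def)

lemma word_prod_Cons [simp]: "word_prod G (a # w) = a \<otimes> word_prod G w"
  by (simp add: word_prod_def)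

lemma word_prod_closed: "set w \<subseteq> carrier G \<Longrightarrow> word_prod G w \<in> carrier G"
  by (induction w) auto

lemma word_prod_append:
  "set v \<subseteq> carrier G \<Longrightarrow> set w \<subseteq> carrier G \<Longrightarrow>
    word_prod G (v @ w) = word_prod G v \<otimes> word_prod G w"
  by (induction v) (auto simp: word_prod_closed m_assoc)

lemma word_prod_Units: "set w \<subseteq> Units G \<Longrightarrow> word_prod G w \<in> Units G"
  by (induction w) auto

lemma letter_mdvd_word_prod:
  assumes "set w \<subseteq> carrier G" "a \<in> set w"
  shows "mdvd G a (word_prod G w)"
  using assms
proof (induction w)
  case (Cons b w)
  have b: "b \<in> carrier G" and w: "word_prod G w \<in> carrier G"
    using Cons.prems word_prod_closed by auto
  then show ?case
    using Cons mdvd_mult_left mdvd_mult_right mdvd_trans by fastforce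
qed simp

text \<open>The products of words over \<open>S\<close> form a submonoid containing
  \<open>S\<close>, hence one of the sets in the intersection that defines the generated
  submonoid.\<close>

lemma submonoid_generated_word:
  assumes S: "S \<subseteq> carrier G" and y: "y \<in> submonoid_generated G S"
  obtains w where "set w \<subseteq> S" "word_prod G w = y"
proof -
  let ?M = "word_prod G ` lists S"
  have "submonoid ?M G"
  proof
    show "?M \<subseteq> carrier G"
      using S word_prod_closed by (auto simp: lists_eq_set)
    show "\<one> \<in> ?M"
      using word_prod_Nil lists.Nil by (metis image_eqI)
    fix x y
    assume "x \<in> ?M" "y \<in> ?M"
    then obtain v w where vw: "set v \<subseteq> S" "set w \<subseteq> S" "x = word_prod G v" "y = word_prod G w"
      by (auto simp: lists_eq_set)
    then have "x \<otimes> y = word_prod G (v @ w)"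
      using S word_prod_append[of v w] by auto
    then show "x \<otimes> y \<in> ?M"
      using vw by (auto simp: lists_eq_set)
  qed
  moreover have "S \<subseteq> ?M"
  proof
    fix s
    assume "s \<in> S"
    then show "s \<in> ?M"
      using S by (intro image_eqI[of _ _ "[s]"]) auto
  qed
  ultimately have "y \<in> ?M"
    using y unfolding submonoid_generated_def by blast
  then show thesis
    using that by (auto simp: lists_eq_set)
qed

section \<open>Factorizations as multisets of divisibility classes\<close>

text \<open>An injection matching equivalent letters is the same as one matching equal classes, so
  both directions reduce to the correspondence between injections and multiset inclusions.\<close>

lemma word_le_iff_mset:
  assumes "set v \<subseteq> carrier G"
  shows "word_le G v w \<longleftrightarrow>
    mset (map (\<lambda>a. Collect (dvd_equiv G a)) v) \<subseteq># mset (map (\<lambda>a. Collect (dvd_equiv G a)) w)"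
    (is "_ \<longleftrightarrow> mset (map ?c v) \<subseteq># mset (map ?c w)")
proof -
  have eq: "dvd_equiv G (v ! i) b \<longleftrightarrow> ?c (v ! i) = ?c b" if "i < length v" for i b
    using dvd_equiv_class_eq_iff assms that by (metis nth_mem subsetD)
  show ?thesis
  proof
    assume "word_le G v w"
    then obtain \<sigma> where \<sigma>: "inj_on \<sigma> {..<length v}" "\<sigma> ` {..<length v} \<subseteq> {..<length w}"
      "\<And>i. i < length v \<Longrightarrow> dvd_equiv G (v ! i) (w ! \<sigma> i)"
      unfolding word_le_def by blast
    then show "mset (map ?c v) \<subseteq># mset (map ?c w)"
      using eq by (intro mset_subset_eq_if_inj[of \<sigma>]) (auto simp: image_subset_iff)
  next
    assume "mset (map ?c v) \<subseteq># mset (map ?c w)"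
    then obtain \<sigma> where \<sigma>: "inj_on \<sigma> {..<length v}" "\<sigma> ` {..<length v} \<subseteq> {..<length w}"
      "\<And>i. i < length v \<Longrightarrow> map ?c v ! i = map ?c w ! \<sigma> i"
      by (rule inj_if_mset_subset_eq) (simp only: length_map)
    have "dvd_equiv G (v ! i) (w ! \<sigma> i)" if "i < length v" for i
    proof -
      have "\<sigma> i < length w" using \<sigma>(2) that by blast
      then show ?thesis using \<sigma>(3)[OF that] eq[OF that] that by simp
    qed
    then show "word_le G v w"
      using \<sigma>(1,2) unfolding word_le_def by blast
  qed
qed

text \<open>A factorization below \<open>w\<close> has a class multiset contained in that of
  \<open>w\<close>. As it cannot be shorter, the two multisets have the same size and
  coincide.\<close>

lemma shortest_factorization_minimal:
  assumes fac: "dvd_factorization G w x"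
    and shortest: "\<And>v. dvd_factorization G v x \<Longrightarrow> length w \<le> length v"
  shows "minimal_factorization G w x"
proof -
  have "word_le G w v" if v: "dvd_factorization G v x" and le: "word_le G v w" for v
  proof -
    let ?M = "\<lambda>w. mset (map (\<lambda>a. Collect (dvd_equiv G a)) w)"
    have carr: "set v \<subseteq> carrier G" "set w \<subseteq> carrier G"
      using v fac by (auto simp: dvd_factorization_def dvd_irreducible_def dvd_nonunits_def)
    have "?M v \<subseteq># ?M w"
      using le word_le_iff_mset[OF carr(1)] by simp
    moreover have "size (?M w) \<le> size (?M v)"
      using shortest[OF v] by simp
    ultimately have "?M v = ?M w"
      by (metis mset_subset_size not_le subset_mset.le_imp_less_or_eq)
    then show ?thesis
      using word_le_iff_mset[OF carr(2)] by simp
  qed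
  then show ?thesis
    using fac unfolding minimal_factorization_def by blast
qed

text \<open>Sending a word to its multiset of classes maps \<open>Z\<close> onto an antichain
  supported on a finite set, which is finite by Dickson's lemma. The equivalence classes of words in
  \<open>Z\<close> are the fibres of this map.\<close>

lemma finite_minimal_factorization_classes:
  assumes Z: "\<And>w. w \<in> Z \<Longrightarrow> minimal_factorization G w x"
    and fin: "finite ((\<lambda>a. Collect (dvd_equiv G a)) ` {a. dvd_irreducible G a \<and> mdvd G a x})"
  shows "finite (Z // {(v, w). v \<in> Z \<and> w \<in> Z \<and> word_equiv G v w})"
proof -
  let ?M = "\<lambda>w. mset (map (\<lambda>a. Collect (dvd_equiv G a)) w)"
  have fac: "dvd_factorization G w x" if "w \<in> Z" for w
    using Z[OF that] by (simp add: minimal_factorization_def)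
  have carr: "set w \<subseteq> carrier G" if "w \<in> Z" for w
    using fac[OF that] by (auto simp: dvd_factorization_def dvd_irreducible_def dvd_nonunits_def)
  have "finite (?M ` Z)"
  proof (rule finite_multiset_antichain[OF fin])
    fix M
    assume "M \<in> ?M ` Z"
    then obtain w where w: "w \<in> Z" "M = ?M w" by blast
    have "dvd_irreducible G a \<and> mdvd G a x" if "a \<in> set w" for a
      using fac[OF w(1)] letter_mdvd_word_prod[OF carr[OF w(1)] that] that
      by (auto simp: dvd_factorization_def)
    then show "set_mset M \<subseteq> (\<lambda>a. Collect (dvd_equiv G a)) ` {a. dvd_irreducible G a \<and> mdvd G a x}"
      by (auto simp: w(2))
  next
    fix M N
    assume "M \<in> ?M ` Z" "N \<in> ?M ` Z" and le: "M \<subseteq># N"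
    then obtain v w where vw: "v \<in> Z" "M = ?M v" "w \<in> Z" "N = ?M w" by blast
    then have "word_le G v w"
      using le word_le_iff_mset[OF carr[OF vw(1)]] by simp
    \<comment> \<open>Minimality of \<open>w\<close> forbids \<open>v\<close> from lying strictly
      below it.\<close>
    then have "word_le G w v"
      using Z[OF vw(3)] fac[OF vw(1)] unfolding minimal_factorization_def by blast
    then have "N \<subseteq># M"
      using vw word_le_iff_mset[OF carr[OF vw(3)]] by simp
    then show "M = N"
      using le by (rule subset_mset.antisym[rotated])
  qed
  moreover have "Z // {(v, w). v \<in> Z \<and> w \<in> Z \<and> word_equiv G v w} \<subseteq>
      (\<lambda>N. {w \<in> Z. ?M w = N}) ` ?M ` Z"
  proof
    fix C
    assume "C \<in> Z // {(v, w). v \<in> Z \<and> w \<in> Z \<and> word_equiv G v w}"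
    then obtain v where v: "v \<in> Z" "C = {w \<in> Z. word_equiv G v w}"
      by (auto simp: quotient_def)
    have "word_equiv G v w \<longleftrightarrow> ?M w = ?M v" if "w \<in> Z" for w
      unfolding word_equiv_def word_le_iff_mset[OF carr[OF v(1)]] word_le_iff_mset[OF carr[OF that]]
      by (metis subset_mset.antisym subset_mset.order_refl)
    then have "C = {w \<in> Z. ?M w = ?M v}"
      using v(2) by blast
    then show "C \<in> (\<lambda>N. {w \<in> Z. ?M w = N}) ` ?M ` Z"
      using v(1) by blast
  qed
  ultimately show ?thesis
    by (meson finite_imageI finite_subset)
qed

end

section \<open>Dedekind-finite monoids\<close>

locale dedekind_finite_monoid = monoid G for G (structure) +
  assumes dedekind_finite: "dedekind_finite G"
begin

text \<open>Dedekind-finiteness makes one factor of a unit invertible; cancelling it exhibits the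
  other as a product of units.\<close>

lemma Units_mult_iff:
  assumes "x \<in> carrier G" "y \<in> carrier G"
  shows "x \<otimes> y \<in> Units G \<longleftrightarrow> x \<in> Units G \<and> y \<in> Units G"
proof
  assume xy: "x \<otimes> y \<in> Units G"
  then consider "x \<in> Units G" | "y \<in> Units G"
    using dedekind_finite assms unfolding dedekind_finite_def by blast
  then show "x \<in> Units G \<and> y \<in> Units G"
  proof cases
    case 1
    then have "y = inv x \<otimes> (x \<otimes> y)"
      using assms by (metis Units_inv_closed Units_l_inv l_one m_assoc)
    then show ?thesis using 1 xy by (metis Units_inv_Units Units_m_closed)
  next
    case 2
    then have "x = (x \<otimes> y) \<otimes> inv y"
      using assms by (metis Units_inv_closed Units_r_inv r_one m_assoc)
    then show ?thesis using 2 xy by (metis Units_inv_Units Units_m_closed)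
  qed
qed simp

lemma mdvd_Units: "mdvd G x y \<Longrightarrow> y \<in> Units G \<Longrightarrow> x \<in> Units G"
  unfolding mdvd_def using Units_mult_iff by auto

text \<open>Divisors of units are units by \<open>Units_mult_iff\<close>. The equality translates
  the notions phrased through divisibility into their ordinary counterparts.\<close>

lemma dvd_units_eq: "dvd_units G = Units G"
proof
  show "dvd_units G \<subseteq> Units G"
    unfolding dvd_units_def dvd_equiv_def using mdvd_Units by blast
  have "dvd_equiv G x \<one>" if "x \<in> Units G" for x
    using dvd_equiv_Units_mult[OF one_closed that Units_one_closed] that
    by (simp add: Units_closed)
  then show "Units G \<subseteq> dvd_units G"
    unfolding dvd_units_def by (auto intro: Units_closed)
qed

lemma dvd_nonunits_eq: "dvd_nonunits G = carrier G - Units G"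
  by (simp add: dvd_nonunits_def dvd_units_eq)

lemma dvd_atom_iff: "dvd_atom G a \<longleftrightarrow> ordinary_atom G a"
  by (simp add: dvd_atom_def ordinary_atom_def dvd_nonunits_eq)

text \<open>A decomposition of \<open>u \<otimes> a \<otimes> v\<close> as
  \<open>x \<otimes> y\<close> pulls back to
  \<open>a = (inv u \<otimes> x) \<otimes> (y \<otimes> inv v)\<close>. The new factors are
  equivalent to \<open>x\<close> and \<open>y\<close>, so they are still non-units and proper
  divisors.\<close>

lemma dvd_irreducible_Units_mult:
  assumes a: "dvd_irreducible G a" and u: "u \<in> Units G" and v: "v \<in> Units G"
  shows "dvd_irreducible G (u \<otimes> a \<otimes> v)" (is "dvd_irreducible G ?b")
proof -
  have ac: "a \<in> carrier G" "a \<notin> Units G"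
    using a by (auto simp: dvd_irreducible_def dvd_nonunits_eq)
  have uc: "u \<in> carrier G" "inv u \<in> carrier G" "inv u \<in> Units G"
    and vc: "v \<in> carrier G" "inv v \<in> carrier G" "inv v \<in> Units G"
    using u v by auto
  have ba: "mdvd G ?b a" "mdvd G a ?b"
    using dvd_equiv_Units_mult[OF ac(1) u v] by (auto simp: dvd_equiv_def)
  have False
    if x: "x \<in> carrier G - Units G" and y: "y \<in> carrier G - Units G"
      and px: "proper_mdvd G x ?b" and py: "proper_mdvd G y ?b" and xy: "?b = x \<otimes> y" for x y
  proof -
    have "a = inv u \<otimes> ?b \<otimes> inv v"
      using ac u v by (metis Units_closed Units_inv_closed m_assoc m_closed Units_l_inv Units_r_inv l_one r_one)
    then have "a = (inv u \<otimes> x) \<otimes> (y \<otimes> inv v)"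
      using x y uc vc xy by (simp add: m_assoc)
    moreover have "dvd_equiv G (inv u \<otimes> x) x"
      using dvd_equiv_Units_mult[OF _ uc(3) Units_one_closed, of x] x uc by simp
    then have "proper_mdvd G (inv u \<otimes> x) a"
      using px ba mdvd_trans unfolding proper_mdvd_def dvd_equiv_def by blast
    moreover have "dvd_equiv G (y \<otimes> inv v) y"
      using dvd_equiv_Units_mult[OF _ Units_one_closed vc(3), of y] y vc by simp
    then have "proper_mdvd G (y \<otimes> inv v) a"
      using py ba mdvd_trans unfolding proper_mdvd_def dvd_equiv_def by blast
    moreover have "inv u \<otimes> x \<in> carrier G - Units G" "y \<otimes> inv v \<in> carrier G - Units G"
      using x y uc vc Units_mult_iff by auto
    ultimately show False
      using a unfolding dvd_irreducible_def dvd_nonunits_eq by blast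
  qed
  moreover have "?b \<in> carrier G - Units G"
    using ac uc vc Units_mult_iff by auto
  ultimately show ?thesis
    unfolding dvd_irreducible_def dvd_nonunits_eq by blast
qed

lemma irreducible_word_closed: "\<forall>a\<in>set w. dvd_irreducible G a \<Longrightarrow> set w \<subseteq> carrier G"
  by (auto simp: dvd_irreducible_def dvd_nonunits_eq)

text \<open>Including the units makes this set closed under multiplication; a non-empty word absorbs an
  adjacent unit into one of its letters.\<close>

definition unit_or_factorable :: "'a set" where
  "unit_or_factorable = Units G \<union> {y. \<exists>w. w \<noteq> [] \<and> dvd_factorization G w y}"

lemma unit_or_factorable_mult:
  assumes y: "y \<in> unit_or_factorable" and z: "z \<in> unit_or_factorable"
  shows "y \<otimes> z \<in> unit_or_factorable"
proof -
  consider "y \<in> Units G" "z \<in> Units G"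
    | w where "y \<in> Units G" "w \<noteq> []" "dvd_factorization G w z"
    | v where "v \<noteq> []" "dvd_factorization G v y" "z \<in> Units G"
    | v w where "v \<noteq> []" "dvd_factorization G v y" "dvd_factorization G w z"
    using y z unfolding unit_or_factorable_def by blast
  then show ?thesis
  proof cases
    case 1
    then show ?thesis by (simp add: unit_or_factorable_def)
  next
    case 2
    then obtain a w' where w: "w = a # w'" by (cases w) auto
    have irr: "\<forall>b\<in>set w. dvd_irreducible G b" and z: "z = word_prod G w"
      using 2 by (auto simp: dvd_factorization_def)
    have carr: "a \<in> carrier G" "set w' \<subseteq> carrier G"
      using irreducible_word_closed[OF irr] by (auto simp: w)
    have "dvd_irreducible G (y \<otimes> a)"
      using dvd_irreducible_Units_mult[of a y \<one>] irr 2(1) carr by (simp add: w Units_closed)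
    moreover have "y \<otimes> z = word_prod G ((y \<otimes> a) # w')"
      using 2(1) carr by (simp add: z w m_assoc Units_closed word_prod_closed)
    ultimately have "dvd_factorization G ((y \<otimes> a) # w') (y \<otimes> z)"
      using irr by (auto simp: dvd_factorization_def w)
    then show ?thesis unfolding unit_or_factorable_def by blast
  next
    case 3
    then obtain v' a where v: "v = v' @ [a]" by (cases v rule: rev_cases) auto
    have irr: "\<forall>b\<in>set v. dvd_irreducible G b" and y: "y = word_prod G v"
      using 3 by (auto simp: dvd_factorization_def)
    have carr: "a \<in> carrier G" "set v' \<subseteq> carrier G"
      using irreducible_word_closed[OF irr] by (auto simp: v)
    have "dvd_irreducible G (a \<otimes> z)"
      using dvd_irreducible_Units_mult[of a \<one> z] irr 3(3) carr by (simp add: v Units_closed)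
    moreover have "y \<otimes> z = word_prod G (v' @ [a \<otimes> z])"
      using 3(3) carr by (simp add: y v m_assoc Units_closed word_prod_closed word_prod_append)
    ultimately have "dvd_factorization G (v' @ [a \<otimes> z]) (y \<otimes> z)"
      using irr by (auto simp: dvd_factorization_def v)
    then show ?thesis unfolding unit_or_factorable_def by blast
  next
    case 4
    then have irr: "\<forall>b\<in>set v. dvd_irreducible G b" "\<forall>b\<in>set w. dvd_irreducible G b"
      by (auto simp: dvd_factorization_def)
    have "dvd_factorization G (v @ w) (y \<otimes> z)"
      using 4 word_prod_append[OF irr[THEN irreducible_word_closed]]
      by (auto simp: dvd_factorization_def)
    then show ?thesis
      using 4(1) unfolding unit_or_factorable_def by blast
  qed
qed

lemma unit_or_factorable_word_prod:
  "set w \<subseteq> unit_or_factorable \<Longrightarrow> word_prod G w \<in> unit_or_factorable"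
  by (induction w) (auto simp: unit_or_factorable_mult, simp add: unit_or_factorable_def)

section \<open>Factorization through finitely many generators\<close>

lemma Units_set_mult_closed: "A \<subseteq> carrier G \<Longrightarrow> Units G <#> A <#> Units G \<subseteq> carrier G"
  by (auto simp: set_mult_def)

text \<open>Every divisor of \<open>x\<close> lies in the submonoid \<open>K\<close>, hence is a
  word over \<open>U <#> A <#> U\<close>. Enlarging \<open>U\<close> to the group of all units frees
  the later arguments from \<open>K\<close>.\<close>

lemma weakly_lfgu_finite_generators:
  assumes "weakly_lfgu G" and x: "x \<in> carrier G - Units G"
  obtains A where "finite A" "A \<subseteq> carrier G"
    "\<And>y. mdvd G y x \<Longrightarrow> \<exists>w. set w \<subseteq> Units G <#> A <#> Units G \<and> word_prod G w = y"
proof -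
  define K where "K = submonoid_generated G {y. mdvd G y x}"
  define U where "U = dvd_units G \<inter> K"
  obtain A where A: "finite A" "A \<subseteq> K" "K = submonoid_generated G (U <#> A <#> U)"
    using assms unfolding weakly_lfgu_def Let_def dvd_nonunits_eq K_def U_def by blast
  \<comment> \<open>The carrier is one of the submonoids being intersected, which places
    \<open>K\<close> inside it.\<close>
  have "submonoid (carrier G) G"
    by unfold_locales auto
  then have "K \<subseteq> carrier G"
    unfolding K_def submonoid_generated_def by (auto simp: mdvd_def)
  then have Ac: "A \<subseteq> carrier G"
    using A(2) by blast
  have sub: "U <#> A <#> U \<subseteq> Units G <#> A <#> Units G"
    by (intro mono_set_mult) (auto simp: U_def dvd_units_eq)
  have "\<exists>w. set w \<subseteq> Units G <#> A <#> Units G \<and> word_prod G w = y" if "mdvd G y x" for y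
  proof -
    have "y \<in> K"
      using that unfolding K_def submonoid_generated_def by blast
    then have "y \<in> submonoid_generated G (U <#> A <#> U)"
      using A(3) by simp
    then obtain w where "set w \<subseteq> U <#> A <#> U" "word_prod G w = y"
      using sub Units_set_mult_closed[OF Ac] by (elim submonoid_generated_word[rotated]) auto
    then show ?thesis using sub by blast
  qed
  then show thesis using A(1) Ac that by blast
qed

text \<open>A generator \<open>a\<close> divides its letter
  \<open>u \<otimes> a \<otimes> v\<close>, which divides the whole product. So \<open>fac\<close>
  applies to every generator that occurs, and closure under multiplication does the rest.\<close>

lemma unit_or_factorable_if_generators:
  assumes A: "A \<subseteq> carrier G"
    and w: "set w \<subseteq> Units G <#> A <#> Units G"
    and fac: "\<And>a. a \<in> A \<Longrightarrow> mdvd G a (word_prod G w) \<Longrightarrow> a \<in> unit_or_factorable"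
  shows "word_prod G w \<in> unit_or_factorable"
proof (rule unit_or_factorable_word_prod, rule subsetI)
  fix b
  assume b: "b \<in> set w"
  then obtain u a v where uav: "u \<in> Units G" "a \<in> A" "v \<in> Units G" "b = u \<otimes> a \<otimes> v"
    using w by (auto simp: set_mult_def)
  have "mdvd G a b"
    using dvd_equiv_Units_mult[of a u v] uav A by (auto simp: dvd_equiv_def)
  moreover have "mdvd G b (word_prod G w)"
    using letter_mdvd_word_prod b w Units_set_mult_closed[OF A] by blast
  ultimately have "a \<in> unit_or_factorable"
    using fac uav(2) mdvd_trans by blast
  moreover have "u \<in> unit_or_factorable" "v \<in> unit_or_factorable"
    using uav by (auto simp: unit_or_factorable_def)
  ultimately show "b \<in> unit_or_factorable"
    using uav(4) unit_or_factorable_mult by blast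
qed

lemma weakly_lfgu_factorization_exists:
  assumes "weakly_lfgu G" and x: "x \<in> carrier G - Units G"
  shows "\<exists>w. dvd_factorization G w x"
proof -
  obtain A where A: "finite A" "A \<subseteq> carrier G"
    "\<And>y. mdvd G y x \<Longrightarrow> \<exists>w. set w \<subseteq> Units G <#> A <#> Units G \<and> word_prod G w = y"
    using weakly_lfgu_finite_generators[OF assms] by blast
  have step: "y \<in> unit_or_factorable"
    if "mdvd G y x" "\<And>a. a \<in> A \<Longrightarrow> mdvd G a y \<Longrightarrow> a \<in> unit_or_factorable" for y
    using A(3)[OF that(1)] unit_or_factorable_if_generators[OF A(2)] that(2) by blast
  have gen: "a \<in> unit_or_factorable" if "a \<in> A" "mdvd G a x" for a
    using that
  \<comment> \<open>The number of elements of \<open>A\<close> dividing \<open>a\<close> serves as a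
    rank for strict divisibility on \<open>A\<close>.\<close>
  proof (induction "card {b \<in> A. mdvd G b a}" arbitrary: a rule: less_induct)
    case less
    have a: "a \<in> carrier G" using less.prems A(2) by blast
    consider "a \<in> Units G" | "dvd_irreducible G a"
      | y z where "proper_mdvd G y a" "proper_mdvd G z a" "a = y \<otimes> z"
      using a unfolding dvd_irreducible_def dvd_nonunits_eq by blast
    then show ?case
    proof cases
      case 1
      then show ?thesis by (simp add: unit_or_factorable_def)
    next
      case 2
      then have "dvd_factorization G [a] a"
        using a by (simp add: dvd_factorization_def)
      then show ?thesis unfolding unit_or_factorable_def by blast
    next
      case 3
      have "y' \<in> unit_or_factorable" if y': "proper_mdvd G y' a" for y'
      proof (rule step)
        show "mdvd G y' x"
          using y' less.prems mdvd_trans unfolding proper_mdvd_def by blast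
        fix b
        assume b: "b \<in> A" "mdvd G b y'"
        then have ba: "mdvd G b a" "\<not> mdvd G a b"
          using y' mdvd_trans unfolding proper_mdvd_def by blast+
        \<comment> \<open>The inclusion is strict because \<open>a\<close> belongs only to the
          right-hand set.\<close>
        have "{c \<in> A. mdvd G c b} \<subset> {c \<in> A. mdvd G c a}"
          using ba less.prems(1) mdvd_refl[OF a] mdvd_trans by blast
        then have "card {c \<in> A. mdvd G c b} < card {c \<in> A. mdvd G c a}"
          using A(1) by (intro psubset_card_mono) auto
        then show "b \<in> unit_or_factorable"
          using less.hyps b(1) mdvd_trans[OF ba(1) less.prems(2)] by blast
      qed
      then show ?thesis
        using 3 unit_or_factorable_mult by blast
    qed
  qed
  \<comment> \<open>\<open>x\<close> may lie outside \<open>A\<close>, so it is reached by one more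
    reduction to the generators dividing it.\<close>
  have "x \<in> unit_or_factorable"
    by (rule step[OF mdvd_refl]) (use x gen in auto)
  then show ?thesis
    using x unfolding unit_or_factorable_def by blast
qed

section \<open>Atoms and finiteness of minimal factorizations\<close>

text \<open>Some letter \<open>s\<close> is a non-unit, since otherwise the product would be a unit.
  Bracketing the product on either side of \<open>s\<close> leaves a non-unit factor containing
  \<open>s\<close>, so the atom property makes the remaining parts \<open>?p\<close> and
  \<open>?q\<close> units.\<close>

lemma ordinary_atom_word_prod:
  assumes w: "set w \<subseteq> carrier G" and atom: "ordinary_atom G (word_prod G w)"
  obtains s where "s \<in> set w" "dvd_equiv G (word_prod G w) s"
proof -
  have "\<not> set w \<subseteq> Units G"
    using atom word_prod_Units unfolding ordinary_atom_def by blast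
  then obtain s where s: "s \<in> set w" "s \<notin> Units G" by blast
  then obtain v v' where v: "w = v @ s # v'" using split_list by fast
  let ?p = "word_prod G v" and ?q = "word_prod G v'"
  have carr: "s \<in> carrier G" "?p \<in> carrier G" "?q \<in> carrier G"
    using w by (auto simp: v word_prod_closed)
  have prod: "word_prod G w = ?p \<otimes> (s \<otimes> ?q)" "word_prod G w = (?p \<otimes> s) \<otimes> ?q"
    using w carr by (auto simp: v word_prod_append m_assoc)
  have "?p \<otimes> s \<in> carrier G - Units G" "s \<otimes> ?q \<in> carrier G - Units G"
    using carr s Units_mult_iff by auto
  then have "?p \<in> Units G" "?q \<in> Units G"
    using atom prod carr unfolding ordinary_atom_def by blast+
  then show thesis
    using that[OF s(1)] dvd_equiv_Units_mult[OF carr(1)] prod(2) by simp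
qed

text \<open>An atom dividing \<open>x\<close> is a word over the generators, hence equivalent to one
  of its letters \<open>u \<otimes> a \<otimes> v\<close>, and so to \<open>a\<close>. Thus each
  class is represented in the finite set \<open>A\<close>.\<close>

lemma weakly_lfgu_finite_atom_classes:
  assumes "weakly_lfgu G" and x: "x \<in> carrier G - Units G"
  shows "finite ((\<lambda>a. Collect (dvd_equiv G a)) ` {a. ordinary_atom G a \<and> mdvd G a x})"
proof -
  obtain A where A: "finite A" "A \<subseteq> carrier G"
    "\<And>y. mdvd G y x \<Longrightarrow> \<exists>w. set w \<subseteq> Units G <#> A <#> Units G \<and> word_prod G w = y"
    using weakly_lfgu_finite_generators[OF assms] by blast
  have "Collect (dvd_equiv G p) \<in> (\<lambda>a. Collect (dvd_equiv G a)) ` A"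
    if p: "ordinary_atom G p" "mdvd G p x" for p
  proof -
    obtain w where w: "set w \<subseteq> Units G <#> A <#> Units G" "word_prod G w = p"
      using A(3)[OF p(2)] by blast
    then obtain s where s: "s \<in> set w" "dvd_equiv G p s"
      using ordinary_atom_word_prod[of w] p(1) Units_set_mult_closed[OF A(2)] by blast
    then obtain u a v where uav: "u \<in> Units G" "a \<in> A" "v \<in> Units G" "s = u \<otimes> a \<otimes> v"
      using w by (auto simp: set_mult_def)
    then have "dvd_equiv G s a"
      using dvd_equiv_Units_mult A(2) by blast
    then have "dvd_equiv G p a"
      using s(2) mdvd_trans unfolding dvd_equiv_def by blast
    then show ?thesis
      using uav(2) p(1) dvd_equiv_class_eq_iff[of p a] by (auto simp: ordinary_atom_def)
  qed
  then have "(\<lambda>a. Collect (dvd_equiv G a)) ` {a. ordinary_atom G a \<and> mdvd G a x}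
      \<subseteq> (\<lambda>a. Collect (dvd_equiv G a)) ` A"
    by blast
  then show ?thesis
    using A(1) finite_subset by blast
qed

text \<open>The assumption \<open>atoms\<close> enters twice: it makes a shortest factorization
  atomic, and it bounds the classes of irreducibles dividing \<open>x\<close> by the finitely many
  classes of atoms.\<close>

lemma weakly_lfgu_FmF_atomic:
  assumes lfgu: "weakly_lfgu G"
    and atoms: "\<And>a. dvd_irreducible G a \<Longrightarrow> ordinary_atom G a"
  shows "FmF_atomic G"
  unfolding FmF_atomic_def Let_def dvd_nonunits_eq
proof (intro ballI conjI)
  fix x
  assume x: "x \<in> carrier G - Units G"
  obtain w where w: "dvd_factorization G w x"
    "\<And>v. dvd_factorization G v x \<Longrightarrow> length w \<le> length v"
    using weakly_lfgu_factorization_exists[OF lfgu x]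
      ex_has_least_nat[of "\<lambda>w. dvd_factorization G w x" _ length] by blast
  then have "w \<in> minimal_atomic_factorizations G x"
    using atoms shortest_factorization_minimal[OF w]
    by (simp add: minimal_atomic_factorizations_def dvd_atom_iff dvd_factorization_def)
  then show "minimal_atomic_factorizations G x \<noteq> {}" by blast
  let ?Z = "minimal_atomic_factorizations G x"
  show "finite (?Z // {(v, w). v \<in> ?Z \<and> w \<in> ?Z \<and> word_equiv G v w})"
  proof (rule finite_minimal_factorization_classes)
    show "minimal_factorization G w x" if "w \<in> ?Z" for w
      using that by (simp add: minimal_atomic_factorizations_def)
    have "{a. dvd_irreducible G a \<and> mdvd G a x} \<subseteq> {a. ordinary_atom G a \<and> mdvd G a x}"
      using atoms by blast
    then show "finite ((\<lambda>a. Collect (dvd_equiv G a)) ` {a. dvd_irreducible G a \<and> mdvd G a x})"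
      using weakly_lfgu_finite_atom_classes[OF lfgu x] by (rule finite_subset[OF image_mono])
  qed
qed

end

theorem theorem5p1:
  fixes H :: "('a, 'b) monoid_scheme"
  assumes "monoid H"
    and "dedekind_finite H"
    and "weakly_lfgu H"
  shows "factorable H \<and>
    ((\<forall>a. dvd_irreducible H a \<longrightarrow> ordinary_atom H a) \<longrightarrow> FmF_atomic H)"
proof -
  interpret dedekind_finite_monoid H
    using assms by (simp add: dedekind_finite_monoid_def dedekind_finite_monoid_axioms_def)
  show ?thesis
    using weakly_lfgu_factorization_exists[OF assms(3)] weakly_lfgu_FmF_atomic[OF assms(3)]
    by (simp add: factorable_def dvd_nonunits_eq)
qed

end
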